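(* Let $k$ be an even nonnegative integer and let $n=|\delta_{2k}/\delta_k|$. Then, as $k\to\infty$ through even integers, $$\frac12-\frac92\log 2+2\log 3+o(1)\;\le\;\frac1n\log f^{\delta_{2k}/\delta_k}-\frac12\log n\;\le\;\frac12-\frac{13}{2}\log 2+\frac72\log 3+o(1).$$
   Context: $\delta_m=(m-1,m-2,\dots,1)$ is the staircase partition; $|\lambda/\mu|$ is the number of cells of the skew Young diagram of $\lambda/\mu$; $f^{\lambda/\mu}$ is the number of standard Young tableaux of skew shape $\lambda/\mu$ (fillings of the cells by $1,\dots,|\lambda/\mu|$, each used once, increasing along rows and down columns). $\log$ is the natural logarithm. *)

theory Defs
  imports Complex_Main "HOL-Library.FuncSet" "HOL-Library.Landau_Symbols"
begin

definition is_partition :: "nat list \<Rightarrow> bool" where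
  "is_partition lam \<longleftrightarrow> sorted_wrt (\<ge>) lam \<and> 0 \<notin> set lam"

(* Rows and columns are indexed from 0, in English notation. *)
definition young_diagram :: "nat list \<Rightarrow> (nat \<times> nat) set" where
  "young_diagram lam = {(i, j). i < length lam \<and> j < lam ! i}"

(* Meaningful as the shape lam/mu when the diagram of mu is contained in that of lam;
   see staircase_diagram_mono for the shapes used here. *)
definition skew_diagram :: "nat list \<Rightarrow> nat list \<Rightarrow> (nat \<times> nat) set" where
  "skew_diagram lam mu = young_diagram lam - young_diagram mu"

(* Tableaux are extensional functions on the cells, so that each filling of D is
   counted exactly once. *)
definition standard_tableaux :: "(nat \<times> nat) set \<Rightarrow> (nat \<times> nat \<Rightarrow> nat) set" where
  "standard_tableaux D =
     {T \<in> extensional D. bij_betw T D {1..card D} \<and>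
        (\<forall>i j j'. (i, j) \<in> D \<longrightarrow> (i, j') \<in> D \<longrightarrow> j < j' \<longrightarrow> T (i, j) < T (i, j')) \<and>
        (\<forall>i i' j. (i, j) \<in> D \<longrightarrow> (i', j) \<in> D \<longrightarrow> i < i' \<longrightarrow> T (i, j) < T (i', j))}"

definition skew_size :: "nat list \<Rightarrow> nat list \<Rightarrow> nat" where
  "skew_size lam mu = card (skew_diagram lam mu)"

definition num_skew_SYT :: "nat list \<Rightarrow> nat list \<Rightarrow> nat" where
  "num_skew_SYT lam mu = card (standard_tableaux (skew_diagram lam mu))"

(* The partition (m-1, m-2, ..., 1); empty for m = 0 and m = 1. *)
definition staircase :: "nat \<Rightarrow> nat list" where
  "staircase m = rev [1..<m]"

lemma is_partition_staircase: "is_partition (staircase m)"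
  by (auto simp: is_partition_def staircase_def sorted_wrt_rev)

lemma young_diagram_staircase: "young_diagram (staircase m) = {(i, j). i + j + 1 < m}"
  by (auto simp: young_diagram_def staircase_def rev_nth)

lemma staircase_diagram_mono:
  "k \<le> m \<Longrightarrow> young_diagram (staircase k) \<subseteq> young_diagram (staircase m)"
  by (auto simp: young_diagram_staircase)

end

theory Submission
  imports Defs "HOL-Real_Asymp.Real_Asymp"
begin

text \<open>
Write $f(S)$ for the number of standard tableaux of shape $S$, and $h_D(u)$ for the hook length of
a cell $u$ in a diagram $D$. The theorem follows from two elementary estimates, applied to
$D=\delta_{2k}$ and $M=\delta_k$ with $n=|D\setminus M|$:
\[
  f(D\setminus M)\;\ge\;\frac{n!}{\prod_{u\in D\setminus M}h_D(u)},
  \qquad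
  f(D\setminus M)\,f(M)\;\le\;f(D).
\]

The first (\<open>skew_hook_bound\<close>) comes from the hook walk of Greene, Nijenhuis and Wilf. If the
starting cell is confined to $D\setminus M$, their argument shows that the right-hand side, as a
function of $D$, is at most the sum of its values for $D$ with one corner outside $M$ removed, while
$f(D\setminus M)$ is equal to the corresponding sum. For empty $M$ all inequalities are equations
and one obtains the hook-length formula (\<open>hook_length_formula\<close>). The second estimate
(\<open>card_standard_tableaux_concat\<close>) continues a tableau of shape $M$ by one of shape $D\setminus M$;
the hook-length formula evaluates $f(M)$ and $f(D)$.

All hooks of a staircase are odd, and the hook products involved are products of double factorials.
Expanding their logarithms up to $o(k^2)$ shows that the lower and the upper bound for
$\frac1n\ln f-\frac12\ln n$ converge to
\[
  \frac16-\frac32\ln2+\frac12\ln3\approx-0.324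
  \qquad\mbox{and}\qquad
  \frac12-\frac16\ln2-\frac12\ln3\approx-0.165 .
\]
These numbers lie strictly between the constants of the theorem, which are approximately $-0.422$
and $-0.160$. On the upper side this amounts to $2^{19}<3^{12}$.
\<close>

section \<open>Diagrams and hooks\<close>

definition diagram :: "(nat \<times> nat) set \<Rightarrow> bool" where
  "diagram D \<longleftrightarrow> finite D \<and> (\<forall>i j i' j'. (i, j) \<in> D \<longrightarrow> i' \<le> i \<longrightarrow> j' \<le> j \<longrightarrow> (i', j') \<in> D)"

lemma diagram_finite: "diagram D \<Longrightarrow> finite D"
  by (simp add: diagram_def)

lemma diagram_down: "diagram D \<Longrightarrow> (i, j) \<in> D \<Longrightarrow> i' \<le> i \<Longrightarrow> j' \<le> j \<Longrightarrow> (i', j') \<in> D"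
  unfolding diagram_def by blast

definition row_len :: "(nat \<times> nat) set \<Rightarrow> nat \<Rightarrow> nat" where
  "row_len D i = card {j. (i, j) \<in> D}"

definition col_len :: "(nat \<times> nat) set \<Rightarrow> nat \<Rightarrow> nat" where
  "col_len D j = card {i. (i, j) \<in> D}"

lemma down_closed_eq_lessThan:
  fixes S :: "nat set"
  assumes "finite S" and down: "\<And>x y. x \<in> S \<Longrightarrow> y \<le> x \<Longrightarrow> y \<in> S"
  shows "S = {..<card S}"
proof -
  define n where "n = (LEAST n. n \<notin> S)"
  have "\<exists>n. n \<notin> S"
    using assms(1) ex_new_if_finite infinite_UNIV_nat by blast
  then have "n \<notin> S" unfolding n_def by (rule LeastI_ex)
  moreover have "x \<in> S" if "x < n" for x
    using not_less_Least that unfolding n_def by blast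
  ultimately have "S = {..<n}"
    using down by (metis lessThan_iff linorder_not_less subset_antisym subsetI)
  then show ?thesis by simp
qed

lemma mem_diagram_row:
  assumes "diagram D" shows "(i, j) \<in> D \<longleftrightarrow> j < row_len D i"
proof -
  have "{j. (i, j) \<in> D} = {..<row_len D i}"
    unfolding row_len_def
  proof (rule down_closed_eq_lessThan)
    have "{j. (i, j) \<in> D} \<subseteq> snd ` D" by force
    then show "finite {j. (i, j) \<in> D}"
      using assms by (meson diagram_finite finite_imageI finite_subset)
  qed (use assms diagram_down in blast)
  then show ?thesis by blast
qed

lemma mem_diagram_col:
  assumes "diagram D" shows "(i, j) \<in> D \<longleftrightarrow> i < col_len D j"
proof -
  have "{i. (i, j) \<in> D} = {..<col_len D j}"
    unfolding col_len_def
  proof (rule down_closed_eq_lessThan)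
    have "{i. (i, j) \<in> D} \<subseteq> fst ` D" by force
    then show "finite {i. (i, j) \<in> D}"
      using assms by (meson diagram_finite finite_imageI finite_subset)
  qed (use assms diagram_down in blast)
  then show ?thesis by blast
qed

definition hook :: "(nat \<times> nat) set \<Rightarrow> nat \<times> nat \<Rightarrow> nat" where
  "hook D = (\<lambda>(i, j). (row_len D i - Suc j) + (col_len D j - Suc i) + 1)"

section \<open>Removing the largest entry\<close>

definition corners :: "(nat \<times> nat) set \<Rightarrow> (nat \<times> nat) set" where
  "corners E = {(a, b) \<in> E. (\<forall>b'. (a, b') \<in> E \<longrightarrow> b' \<le> b) \<and> (\<forall>a'. (a', b) \<in> E \<longrightarrow> a' \<le> a)}"

lemma finite_corners: "finite E \<Longrightarrow> finite (corners E)"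
  by (rule rev_finite_subset) (auto simp: corners_def)

lemma finite_standard_tableaux:
  assumes "finite E" shows "finite (standard_tableaux E)"
proof -
  have "standard_tableaux E \<subseteq> PiE E (\<lambda>_. {1..card E})"
    by (auto simp: standard_tableaux_def PiE_def bij_betw_def)
  then show ?thesis using assms by (meson finite_PiE finite_atLeastAtMost finite_subset)
qed

lemma standard_tableau_max_at_corner:
  assumes "finite E" "E \<noteq> {}" "T \<in> standard_tableaux E"
  shows "\<exists>c \<in> corners E. T c = card E"
proof -
  have bij: "bij_betw T E {1..card E}" using assms(3) by (simp add: standard_tableaux_def)
  have "card E \<in> {1..card E}" using assms(1,2) by (simp add: Suc_leI card_gt_0_iff)
  then obtain a b where ab: "(a, b) \<in> E" "T (a, b) = card E"
    using bij by (metis bij_betw_imp_surj_on image_iff surj_pair)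
  have le: "T u \<le> card E" if "u \<in> E" for u
    using bij_betwE[OF bij] that by fastforce
  have "b' \<le> b" if "(a, b') \<in> E" for b'
    using assms(3) ab le[OF that] that by (force simp: standard_tableaux_def not_le[symmetric])
  moreover have "a' \<le> a" if "(a', b) \<in> E" for a'
    using assms(3) ab le[OF that] that by (force simp: standard_tableaux_def not_le[symmetric])
  ultimately have "(a, b) \<in> corners E" using ab by (auto simp: corners_def)
  then show ?thesis using ab by blast
qed

lemma standard_tableaux_remove_corner:
  assumes fin: "finite E" and c: "c \<in> corners E"
  shows "bij_betw (\<lambda>T. T(c := card E)) (standard_tableaux (E - {c}))
           {T \<in> standard_tableaux E. T c = card E}"
proof (rule bij_betw_byWitness[where f' = "\<lambda>T. T(c := undefined)"])
  have cE: "c \<in> E" using c by (auto simp: corners_def)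
  define n where "n = card (E - {c})"
  have card: "card E = Suc n" unfolding n_def by (rule card.remove[OF fin cE])
  have ins: "insert (Suc n) {1..n} = {1..Suc n}" by auto
  show "\<forall>T\<in>standard_tableaux (E - {c}). (T(c := card E))(c := undefined) = T"
    by (auto simp: standard_tableaux_def extensional_def fun_eq_iff)
  show "\<forall>T\<in>{T \<in> standard_tableaux E. T c = card E}. (T(c := undefined))(c := card E) = T"
    by auto
  show "(\<lambda>T. T(c := card E)) ` standard_tableaux (E - {c})
          \<subseteq> {T \<in> standard_tableaux E. T c = card E}"
  proof safe
    fix T assume T: "T \<in> standard_tableaux (E - {c})"
    then have bij: "bij_betw T (E - {c}) {1..n}" by (simp add: standard_tableaux_def n_def)
    have le: "T u < Suc n" if "u \<in> E - {c}" for u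
      using bij_betwE[OF bij] that by (metis atLeastAtMost_iff less_Suc_eq_le)
    have "bij_betw (T(c := Suc n)) (E - {c}) {1..n}"
      using bij by (subst bij_betw_cong[where g = T]) auto
    then have "bij_betw (T(c := Suc n)) (insert c (E - {c})) (insert (Suc n) {1..n})"
      using notIn_Un_bij_betw[of c "E - {c}" "T(c := Suc n)" "{1..n}"] by auto
    then have "bij_betw (T(c := card E)) E {1..card E}"
      unfolding card ins using cE by (simp add: insert_absorb)
    then show "T(c := card E) \<in> standard_tableaux E"
      using T c le cE unfolding standard_tableaux_def card
      by (cases c) (auto simp: extensional_def corners_def)
    show "(T(c := card E)) c = card E" by simp
  qed
  show "(\<lambda>T. T(c := undefined)) ` {T \<in> standard_tableaux E. T c = card E}
          \<subseteq> standard_tableaux (E - {c})"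
  proof safe
    fix T assume T: "T \<in> standard_tableaux E" and Tc: "T c = card E"
    have "bij_betw T E {1..card E}" using T by (simp add: standard_tableaux_def)
    then have "bij_betw T (E - {c}) ({1..card E} - {T c})"
    proof (rule bij_betw_DiffI[OF _ bij_betw_singletonI[OF refl]])
      show "{T c} \<subseteq> {1..card E}" using Tc card by simp
    qed (use cE in simp)
    then have "bij_betw T (E - {c}) ({1..card E} - {card E})" by (simp only: Tc)
    moreover have "{1..card E} - {card E} = {1..n}" using card by auto
    ultimately have "bij_betw (T(c := undefined)) (E - {c}) {1..n}"
      by (subst bij_betw_cong[where g = T]) auto
    then show "T(c := undefined) \<in> standard_tableaux (E - {c})"
      using T unfolding standard_tableaux_def n_def
      by (cases c) (auto simp: extensional_def)
  qed
qed

text \<open>The largest entry of a standard tableau lies in a corner, and erasing it leaves a standard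
tableau on the remaining cells.\<close>

lemma card_standard_tableaux_recursion:
  assumes "finite E" "E \<noteq> {}"
  shows "card (standard_tableaux E) = (\<Sum>c\<in>corners E. card (standard_tableaux (E - {c})))"
proof -
  have eq: "standard_tableaux E = (\<Union>c\<in>corners E. {T \<in> standard_tableaux E. T c = card E})"
    using standard_tableau_max_at_corner[OF assms] by blast
  have finc: "finite (corners E)"
    by (rule finite_corners[OF assms(1)])
  have "card (standard_tableaux E) = (\<Sum>c\<in>corners E. card {T \<in> standard_tableaux E. T c = card E})"
  proof (subst eq, rule card_UN_disjoint[OF finc])
    show "\<forall>c\<in>corners E. finite {T \<in> standard_tableaux E. T c = card E}"
      using finite_standard_tableaux[OF assms(1)] by simp
    show "\<forall>c\<in>corners E. \<forall>c'\<in>corners E. c \<noteq> c' \<longrightarrow>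
        {T \<in> standard_tableaux E. T c = card E} \<inter> {T \<in> standard_tableaux E. T c' = card E} = {}"
    proof (intro ballI impI equals0I)
      fix c c' T assume cc': "c \<in> corners E" "c' \<in> corners E" "c \<noteq> c'"
        and T: "T \<in> {T \<in> standard_tableaux E. T c = card E} \<inter> {T \<in> standard_tableaux E. T c' = card E}"
      then have "c \<in> E" "c' \<in> E" by (auto simp: corners_def)
      moreover have "inj_on T E" using T by (simp add: standard_tableaux_def bij_betw_def)
      ultimately have "T c \<noteq> T c'" using cc'(3) inj_onD by metis
      then show False using T by simp
    qed
  qed
  also have "\<dots> = (\<Sum>c\<in>corners E. card (standard_tableaux (E - {c})))"
    using bij_betw_same_card[OF standard_tableaux_remove_corner[OF assms(1)]]
    by (intro sum.cong) auto
  finally show ?thesis .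
qed

section \<open>The end point of a hook walk\<close>

text \<open>A hook walk starts in a cell of a diagram and keeps moving to a uniformly chosen other cell of
the hook of the current cell, until it is stuck in a corner. The probability of ending in a given
corner $(a,b)$ turns out to be a product of a factor for the starting row and a factor for the
starting column. Each factor is a value of the function below, in closed form: it expands to a sum
over all sets of rows (or columns) that the walk can visit on its way, where \<open>w\<close> is the arm plus
leg of the cells in the column (or row) of the corner.\<close>

definition walk_weight :: "(nat \<Rightarrow> real) \<Rightarrow> nat \<Rightarrow> nat \<Rightarrow> real" where
  "walk_weight w a i = (if i = a then 1 else (\<Prod>r\<in>{Suc i..<a}. 1 + 1 / w r) / w i)"

text \<open>The sum telescopes, because
$\prod_{i\le r<a}(1+1/w_r)-\prod_{i<r<a}(1+1/w_r)$ is the weight of $i$. This is where the hook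
products enter: with $w_r=h_r-1$ the factors are the quotients $h_r/(h_r-1)$ by which hooks change
when the corner is removed.\<close>

lemma sum_walk_weight:
  assumes "i \<le> a" and "\<And>r. r < a \<Longrightarrow> w r > 0"
  shows "(\<Sum>r\<in>{i..a}. walk_weight w a r) = (\<Prod>r\<in>{i..<a}. 1 + 1 / w r)"
  using assms(1)
proof (induction rule: inc_induct)
  case base
  show ?case by (simp add: walk_weight_def)
next
  case (step i)
  have "{i..a} = insert i {Suc i..a}" "{i..<a} = insert i {Suc i..<a}"
    using step.hyps by auto
  then show ?case using step assms(2)[of i]
    by (simp add: walk_weight_def field_simps)
qed

lemma walk_weight_harmonic:
  assumes "i \<le> a" and pos: "\<And>r. r < a \<Longrightarrow> w r > 0" and "w a = 0"
  shows "w i * walk_weight w a i = (\<Sum>r\<in>{i<..a}. walk_weight w a r)"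
proof (cases "i = a")
  case False
  then have "{i<..a} = {Suc i..a}" "Suc i \<le> a" using assms(1) by auto
  moreover have "w i \<noteq> 0" using pos[of i] False assms(1) by simp
  ultimately show ?thesis
    using sum_walk_weight[OF \<open>Suc i \<le> a\<close> pos] False
    by (simp add: walk_weight_def[of w a i])
qed (use assms in simp)

lemma walk_weight_nonneg:
  assumes "i \<le> a" and pos: "\<And>r. r < a \<Longrightarrow> w r > 0"
  shows "walk_weight w a i \<ge> 0"
proof -
  have "(\<Prod>r\<in>{Suc i..<a}. 1 + 1 / w r) \<ge> 0"
    by (intro prod_nonneg) (simp add: less_imp_le[OF pos])
  moreover have "w i \<ge> 0" if "i \<noteq> a"
    using pos[of i] that assms(1) by simp
  ultimately show ?thesis by (simp add: walk_weight_def)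
qed

text \<open>Arm plus leg: the number of cells to which a hook walk can move next.\<close>

definition excess :: "(nat \<times> nat) set \<Rightarrow> nat \<times> nat \<Rightarrow> real" where
  "excess D u = real (hook D u) - 1"

definition walk_prob :: "(nat \<times> nat) set \<Rightarrow> nat \<times> nat \<Rightarrow> nat \<times> nat \<Rightarrow> real" where
  "walk_prob D = (\<lambda>(a, b) (i, j).
     if i \<le> a \<and> j \<le> b
     then walk_weight (\<lambda>r. excess D (r, b)) a i * walk_weight (\<lambda>s. excess D (a, s)) b j
     else 0)"

lemma corner_lens:
  assumes "diagram D" "(a, b) \<in> corners D"
  shows "row_len D a = Suc b" "col_len D b = Suc a"
proof -
  have ab: "(a, b) \<in> D" "(a, Suc b) \<notin> D" "(Suc a, b) \<notin> D"
    using assms(2) by (auto simp: corners_def)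
  then show "row_len D a = Suc b" "col_len D b = Suc a"
    using mem_diagram_row[OF assms(1)] mem_diagram_col[OF assms(1)]
    by (metis le_antisym linorder_not_less Suc_leI)+
qed

lemma excess_eq:
  assumes "diagram D" "(i, j) \<in> D"
  shows "excess D (i, j) = real (row_len D i) + real (col_len D j) - real i - real j - 2"
proof -
  have "j < row_len D i" "i < col_len D j"
    using assms mem_diagram_row mem_diagram_col by blast+
  then show ?thesis by (simp add: excess_def hook_def of_nat_diff)
qed

lemma excess_below_corner:
  assumes "diagram D" "(a, b) \<in> corners D"
  shows "r < a \<Longrightarrow> excess D (r, b) > 0" "s < b \<Longrightarrow> excess D (a, s) > 0"
    and "excess D (a, b) = 0"
proof -
  have ab: "(a, b) \<in> D" using assms(2) by (auto simp: corners_def)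
  note len = corner_lens[OF assms]
  show "excess D (a, b) = 0" using excess_eq[OF assms(1) ab] len by simp
  show "excess D (r, b) > 0" if "r < a"
  proof -
    have m: "(r, b) \<in> D" using diagram_down[OF assms(1) ab] that by simp
    then have "b < row_len D r" using mem_diagram_row assms(1) by blast
    then show ?thesis using excess_eq[OF assms(1) m] len that by simp
  qed
  show "excess D (a, s) > 0" if "s < b"
  proof -
    have m: "(a, s) \<in> D" using diagram_down[OF assms(1) ab] that by simp
    then have "a < col_len D s" using mem_diagram_col assms(1) by blast
    then show ?thesis using excess_eq[OF assms(1) m] len that by simp
  qed
qed

text \<open>The fact about hooks that makes the end point distribution factor: arm and leg of $(i,j)$ are
those of its two projections to the column and the row of the corner, taken together.\<close>

lemma excess_splits:
  assumes "diagram D" "(a, b) \<in> corners D" "i \<le> a" "j \<le> b"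
  shows "excess D (i, j) = excess D (i, b) + excess D (a, j)"
proof -
  have ab: "(a, b) \<in> D" using assms(2) by (auto simp: corners_def)
  have "(i, j) \<in> D" "(i, b) \<in> D" "(a, j) \<in> D"
    using diagram_down[OF assms(1) ab] assms(3,4) by simp_all
  then show ?thesis
    using corner_lens[OF assms(1,2)] by (simp add: excess_eq[OF assms(1)])
qed

text \<open>Averaging over the first step of the walk. The equation characterises the distribution of the end
point, so the walk itself never has to be constructed. It follows from the one-dimensional
equation for \<open>walk_weight\<close> in the row and in the column, since their coefficients add up by
\<open>excess_splits\<close>.\<close>

lemma walk_prob_harmonic:
  assumes D: "diagram D" and c: "c \<in> corners D" and u: "(i, j) \<in> D"
  shows "excess D (i, j) * walk_prob D c (i, j) =
           (\<Sum>s\<in>{j<..<row_len D i}. walk_prob D c (i, s)) +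
           (\<Sum>r\<in>{i<..<col_len D j}. walk_prob D c (r, j))"
proof -
  obtain a b where [simp]: "c = (a, b)" by (cases c)
  note c = c[simplified]
  note ex = excess_below_corner[OF D c]
  show ?thesis
  proof (cases "i \<le> a \<and> j \<le> b")
    case True
    define X where "X = walk_weight (\<lambda>r. excess D (r, b)) a"
    define Y where "Y = walk_weight (\<lambda>s. excess D (a, s)) b"
    have ab: "(a, b) \<in> D" using c by (auto simp: corners_def)
    have "b < row_len D i" "a < col_len D j"
      using diagram_down[OF D ab] True mem_diagram_row[OF D] mem_diagram_col[OF D] by blast+
    then have sub: "{j<..b} \<subseteq> {j<..<row_len D i}" "{i<..a} \<subseteq> {i<..<col_len D j}" by auto
    have "(\<Sum>s\<in>{j<..<row_len D i}. walk_prob D c (i, s)) = (\<Sum>s\<in>{j<..b}. walk_prob D c (i, s))"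
      by (rule sum.mono_neutral_right[OF _ sub(1)]) (auto simp: walk_prob_def)
    also have "\<dots> = X i * (\<Sum>s\<in>{j<..b}. Y s)"
      using True by (simp add: walk_prob_def sum_distrib_left X_def Y_def)
    also have "(\<Sum>s\<in>{j<..b}. Y s) = excess D (a, j) * Y j"
      unfolding Y_def using True ex by (subst walk_weight_harmonic) auto
    finally have row: "(\<Sum>s\<in>{j<..<row_len D i}. walk_prob D c (i, s)) = X i * (excess D (a, j) * Y j)" .
    have "(\<Sum>r\<in>{i<..<col_len D j}. walk_prob D c (r, j)) = (\<Sum>r\<in>{i<..a}. walk_prob D c (r, j))"
      by (rule sum.mono_neutral_right[OF _ sub(2)]) (auto simp: walk_prob_def)
    also have "\<dots> = (\<Sum>r\<in>{i<..a}. X r) * Y j"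
      using True by (simp add: walk_prob_def sum_distrib_right X_def Y_def)
    also have "(\<Sum>r\<in>{i<..a}. X r) = excess D (i, b) * X i"
      unfolding X_def using True ex by (subst walk_weight_harmonic) auto
    finally have col: "(\<Sum>r\<in>{i<..<col_len D j}. walk_prob D c (r, j)) = excess D (i, b) * X i * Y j" .
    show ?thesis
      unfolding row col excess_splits[OF D c conjunct1[OF True] conjunct2[OF True]]
      using True by (simp add: walk_prob_def X_def Y_def algebra_simps)
  next
    case False
    then show ?thesis by (auto simp add: walk_prob_def)
  qed
qed

text \<open>The walk ends in some corner. In a corner the only contribution is that of the corner itself;
elsewhere the sum is, by the harmonic equation, the mean of the sums over the cells that the
walk can reach next, which are farther from the origin.\<close>

lemma sum_walk_prob:
  assumes D: "diagram D" and "u \<in> D"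
  shows "(\<Sum>c\<in>corners D. walk_prob D c u) = 1"
proof -
  obtain K where K: "\<And>i j. (i, j) \<in> D \<Longrightarrow> i + j < K"
  proof -
    have "finite ((\<lambda>(i, j). i + j) ` D)" using diagram_finite[OF D] by simp
    then obtain K where "\<forall>n \<in> (\<lambda>(i, j). i + j) ` D. n < K"
      using finite_nat_set_iff_bounded by blast
    then show ?thesis using that by fastforce
  qed
  have "(\<Sum>c\<in>corners D. walk_prob D c (i, j)) = 1" if "(i, j) \<in> D" for i j
    using that
  proof (induction "K - (i + j)" arbitrary: i j rule: less_induct)
    case less
    let ?R = "{j<..<row_len D i}" and ?C = "{i<..<col_len D j}"
    have len: "j < row_len D i" "i < col_len D j"
      using less.prems mem_diagram_row[OF D] mem_diagram_col[OF D] by blast+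
    have hR: "(\<Sum>c\<in>corners D. walk_prob D c (i, s)) = 1" if "s \<in> ?R" for s
    proof -
      have "(i, s) \<in> D" using that mem_diagram_row[OF D] by simp
      then show ?thesis using less.hyps[of i s] that K[of i s] by (simp add: diff_less_mono2)
    qed
    have hC: "(\<Sum>c\<in>corners D. walk_prob D c (r, j)) = 1" if "r \<in> ?C" for r
    proof -
      have "(r, j) \<in> D" using that mem_diagram_col[OF D] by simp
      then show ?thesis using less.hyps[of r j] that K[of r j] by (simp add: diff_less_mono2)
    qed
    show ?case
    proof (cases "(i, j) \<in> corners D")
      case True
      have "walk_prob D c (i, j) = 0" if "c \<in> corners D - {(i, j)}" for c
      proof -
        obtain a b where [simp]: "c = (a, b)" by (cases c)
        have ab: "(a, b) \<in> D" using that by (auto simp: corners_def)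
        have "\<not> (i \<le> a \<and> j \<le> b)"
        proof
          assume le: "i \<le> a \<and> j \<le> b"
          then have "(i, b) \<in> D" "(a, j) \<in> D" using diagram_down[OF D ab] by simp_all
          then have "b \<le> j" "a \<le> i" using True by (auto simp: corners_def)
          then show False using le that by simp
        qed
        then show ?thesis by (simp only: walk_prob_def \<open>c = (a, b)\<close> prod.case if_False)
      qed
      then have "(\<Sum>c\<in>corners D. walk_prob D c (i, j)) = (\<Sum>c\<in>{(i, j)}. walk_prob D c (i, j))"
        using True finite_corners[OF diagram_finite[OF D]]
        by (intro sum.mono_neutral_right) auto
      also have "\<dots> = 1" by (simp add: walk_prob_def walk_weight_def)
      finally show ?thesis .
    next
      case False
      have "excess D (i, j) * (\<Sum>c\<in>corners D. walk_prob D c (i, j)) =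
          (\<Sum>c\<in>corners D. (\<Sum>s\<in>?R. walk_prob D c (i, s)) + (\<Sum>r\<in>?C. walk_prob D c (r, j)))"
        unfolding sum_distrib_left by (intro sum.cong refl walk_prob_harmonic D less.prems)
      also have "\<dots> = (\<Sum>s\<in>?R. \<Sum>c\<in>corners D. walk_prob D c (i, s)) +
                       (\<Sum>r\<in>?C. \<Sum>c\<in>corners D. walk_prob D c (r, j))"
        unfolding sum.distrib
        by (subst sum.swap, subst (2) sum.swap) simp
      also have "\<dots> = real (card ?R) + real (card ?C)"
        using hR hC by simp
      also have "\<dots> = excess D (i, j)"
        using len by (simp add: excess_def hook_def)
      finally have *: "excess D (i, j) * (\<Sum>c\<in>corners D. walk_prob D c (i, j)) = excess D (i, j)" .
      have "excess D (i, j) \<noteq> 0"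
      proof
        assume "excess D (i, j) = 0"
        then have "row_len D i = Suc j" "col_len D j = Suc i"
          using len by (auto simp: excess_def hook_def)
        then have "b' \<le> j" if "(i, b') \<in> D" for b'
          using that mem_diagram_row[OF D, of i b'] by simp
        moreover have "a' \<le> i" if "(a', j) \<in> D" for a'
          using that mem_diagram_col[OF D, of a' j] \<open>col_len D j = Suc i\<close> by simp
        ultimately have "(i, j) \<in> corners D"
          using less.prems by (auto simp: corners_def)
        with False show False ..
      qed
      with * show ?thesis by simp
    qed
  qed
  then show ?thesis using assms(2) by (cases u) simp
qed

section \<open>The hook bound for skew shapes\<close>

lemma diagram_remove_corner:
  assumes D: "diagram D" and c: "c \<in> corners D"
  shows "diagram (D - {c})"
  unfolding diagram_def
proof (intro conjI allI impI)
  show "finite (D - {c})" using diagram_finite[OF D] by simp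
  fix i j i' j' assume ij: "(i, j) \<in> D - {c}" "i' \<le> i" "j' \<le> j"
  have "(i', j') \<noteq> c"
  proof
    assume eq: "(i', j') = c"
    have "(i', j) \<in> D" "(i, j') \<in> D"
      using diagram_down[OF D] ij by blast+
    then have "j \<le> j'" "i \<le> i'" using c eq by (auto simp: corners_def)
    then show False using ij eq by auto
  qed
  then show "(i', j') \<in> D - {c}" using diagram_down[OF D, of i j i' j'] ij by blast
qed

lemma nat_eqI_less:
  fixes m n :: nat
  assumes "\<And>x. x < m \<longleftrightarrow> x < n" shows "m = n"
  using assms by (metis linorder_neqE_nat less_irrefl)

lemma lens_remove_corner:
  assumes D: "diagram D" and c: "(a, b) \<in> corners D"
  shows "row_len (D - {(a, b)}) i = (if i = a then b else row_len D i)"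
    and "col_len (D - {(a, b)}) j = (if j = b then a else col_len D j)"
proof -
  have "x < row_len (D - {(a, b)}) i \<longleftrightarrow> x < (if i = a then b else row_len D i)" for x
    using corner_lens[OF D c] mem_diagram_row[OF D, of i x]
    unfolding mem_diagram_row[OF diagram_remove_corner[OF D c], symmetric] by auto
  then show "row_len (D - {(a, b)}) i = (if i = a then b else row_len D i)"
    by (rule nat_eqI_less)
  have "x < col_len (D - {(a, b)}) j \<longleftrightarrow> x < (if j = b then a else col_len D j)" for x
    using corner_lens[OF D c] mem_diagram_col[OF D, of x j]
    unfolding mem_diagram_col[OF diagram_remove_corner[OF D c], symmetric] by auto
  then show "col_len (D - {(a, b)}) j = (if j = b then a else col_len D j)"
    by (rule nat_eqI_less)
qed

lemma corners_skew:
  assumes "diagram D" "diagram M"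
  shows "corners (D - M) = corners D - M"
proof -
  have "b' \<le> b" if "(a, b) \<notin> M" "(a, b') \<in> M" for a b b'
    using diagram_down[OF assms(2) that(2), of a b] that(1) by linarith
  moreover have "a' \<le> a" if "(a, b) \<notin> M" "(a', b) \<in> M" for a a' b
    using diagram_down[OF assms(2) that(2), of a b] that(1) by linarith
  ultimately show ?thesis unfolding corners_def by blast
qed

text \<open>The quotient of the hook products of $D\setminus M$ before and after removal of the corner
$(a,b)$: only the hooks in the row and the column of the corner change, each by one.\<close>

definition corner_ratio :: "(nat \<times> nat) set \<Rightarrow> (nat \<times> nat) set \<Rightarrow> nat \<times> nat \<Rightarrow> real" where
  "corner_ratio D M = (\<lambda>(a, b).
     (\<Prod>r\<in>{col_len M b..<a}. 1 + 1 / excess D (r, b)) *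
     (\<Prod>s\<in>{row_len M a..<b}. 1 + 1 / excess D (a, s)))"

lemma hook_remove_corner:
  assumes D: "diagram D" and c: "(a, b) \<in> corners D" and u: "u \<in> D - {(a, b)}"
  shows "real (hook D u) = real (hook (D - {(a, b)}) u) *
           ((if snd u = b then 1 + 1 / excess D u else 1) *
            (if fst u = a then 1 + 1 / excess D u else 1))"
proof -
  obtain i j where [simp]: "u = (i, j)" by (cases u)
  note u = u[simplified \<open>u = (i, j)\<close>]
  have ex: "excess (D - {(a, b)}) (i, j) = excess D (i, j) - of_bool (j = b) - of_bool (i = a)"
    using u corner_lens[OF D c]
    by (simp add: excess_eq[OF D] excess_eq[OF diagram_remove_corner[OF D c] u]
        lens_remove_corner[OF D c])
  have hook: "real (hook E v) = excess E v + 1" for E v by (simp add: excess_def)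
  consider "j = b" "i \<noteq> a" "i < a" | "i = a" "j \<noteq> b" "j < b" | "i \<noteq> a" "j \<noteq> b"
    using u c by (auto simp: corners_def le_less)
  then show ?thesis
  proof cases
    case 1
    then show ?thesis using ex excess_below_corner(1)[OF D c, of i]
      by (simp add: hook field_simps)
  next
    case 2
    then show ?thesis using ex excess_below_corner(2)[OF D c, of j]
      by (simp add: hook field_simps)
  next
    case 3
    then show ?thesis using ex by (simp add: hook)
  qed
qed

lemma prod_hook_remove_corner:
  assumes D: "diagram D" and M: "diagram M" and c: "c \<in> corners D - M"
  shows "(\<Prod>u\<in>D - M. real (hook D u)) =
           (\<Prod>u\<in>D - M - {c}. real (hook (D - {c}) u)) * corner_ratio D M c"
proof -
  obtain a b where c_eq: "c = (a, b)" by (cases c)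
  have c': "(a, b) \<in> corners D" and nM: "(a, b) \<notin> M" using c c_eq by auto
  then have ab: "(a, b) \<in> D" by (auto simp: corners_def)
  let ?E = "D - M - {(a, b)}" and ?e = "\<lambda>u. 1 + 1 / excess D u"
  have fin: "finite ?E" using diagram_finite[OF D] by simp
  have "real (hook D (a, b)) = 1"
    using excess_below_corner(3)[OF D c'] by (simp add: excess_def)
  then have "(\<Prod>u\<in>D - M. real (hook D u)) = (\<Prod>u\<in>?E. real (hook D u))"
    using ab nM diagram_finite[OF D] by (subst prod.remove[of _ "(a, b)"]) auto
  also have "\<dots> = (\<Prod>u\<in>?E. real (hook (D - {(a, b)}) u) *
      ((if snd u = b then ?e u else 1) * (if fst u = a then ?e u else 1)))"
    by (intro prod.cong refl hook_remove_corner[OF D c']) auto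
  also have "\<dots> = (\<Prod>u\<in>?E. real (hook (D - {(a, b)}) u)) *
      ((\<Prod>u\<in>?E. if snd u = b then ?e u else 1) * (\<Prod>u\<in>?E. if fst u = a then ?e u else 1))"
    by (simp add: prod.distrib)
  also have "(\<Prod>u\<in>?E. if snd u = b then ?e u else 1) = (\<Prod>r\<in>{col_len M b..<a}. ?e (r, b))"
  proof -
    have "{u \<in> ?E. snd u = b} = (\<lambda>r. (r, b)) ` {col_len M b..<a}"
      using mem_diagram_col[OF D] mem_diagram_col[OF M] corner_lens[OF D c'] by fastforce
    then show ?thesis
      by (simp add: prod.inter_filter[OF fin, symmetric] prod.reindex inj_on_def)
  qed
  also have "(\<Prod>u\<in>?E. if fst u = a then ?e u else 1) = (\<Prod>s\<in>{row_len M a..<b}. ?e (a, s))"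
  proof -
    have "{u \<in> ?E. fst u = a} = (\<lambda>s. (a, s)) ` {row_len M a..<b}"
      using mem_diagram_row[OF D] mem_diagram_row[OF M] corner_lens[OF D c'] by fastforce
    then show ?thesis
      by (simp add: prod.inter_filter[OF fin, symmetric] prod.reindex inj_on_def)
  qed
  finally show ?thesis by (simp add: corner_ratio_def c_eq)
qed

lemma walk_prob_nonneg:
  assumes "diagram D" "c \<in> corners D"
  shows "walk_prob D c u \<ge> 0"
proof -
  obtain a b i j where "c = (a, b)" "u = (i, j)" by (cases c, cases u)
  then show ?thesis
    using excess_below_corner[OF assms(1), of a b] assms(2)
    by (auto simp: walk_prob_def intro!: mult_nonneg_nonneg walk_weight_nonneg)
qed

text \<open>The expected number of starting cells of $D\setminus M$ from which the walk ends in the given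
corner. If $(i,j)$ lies outside $M$ and weakly above and to the left of the corner, then so do its
projections to the row and the column of the corner. Hence these starting cells lie in a
rectangle, over which the sum factors and telescopes to the quotient of hook products. The
rectangle may contain cells of $M$ as well; this is the only source of the inequality, and it
disappears when $M$ is empty.\<close>

lemma sum_walk_prob_skew:
  assumes D: "diagram D" and M: "diagram M" and c: "c \<in> corners D - M"
  shows "(\<Sum>u\<in>D - M. walk_prob D c u) \<le> corner_ratio D M c"
    and "M = {} \<Longrightarrow> (\<Sum>u\<in>D - M. walk_prob D c u) = corner_ratio D M c"
proof -
  obtain a b where c_eq: "c = (a, b)" by (cases c)
  have c': "(a, b) \<in> corners D" and nM: "(a, b) \<notin> M" using c c_eq by auto
  then have ab: "(a, b) \<in> D" by (auto simp: corners_def)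
  note ex = excess_below_corner[OF D c']
  let ?R = "{col_len M b..a} \<times> {row_len M a..b}" and ?S = "{..a} \<times> {..b} - M"
  have "{..a} \<times> {..b} \<subseteq> D" using diagram_down[OF D ab] by auto
  then have "(\<Sum>u\<in>D - M. walk_prob D c u) = (\<Sum>u\<in>?S. walk_prob D c u)"
    using diagram_finite[OF D] by (intro sum.mono_neutral_right) (auto simp: c_eq walk_prob_def split: if_splits)
  moreover have "(\<Sum>u\<in>?R. walk_prob D c u) = corner_ratio D M c"
  proof -
    let ?X = "walk_weight (\<lambda>r. excess D (r, b)) a" and ?Y = "walk_weight (\<lambda>s. excess D (a, s)) b"
    have le: "col_len M b \<le> a" "row_len M a \<le> b"
      using nM mem_diagram_col[OF M] mem_diagram_row[OF M] by (metis linorder_not_less)+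
    have "(\<Sum>u\<in>?R. walk_prob D c u) = (\<Sum>(i, j)\<in>?R. ?X i * ?Y j)"
      by (intro sum.cong) (auto simp: walk_prob_def c_eq)
    also have "\<dots> = (\<Sum>i\<in>{col_len M b..a}. ?X i) * (\<Sum>j\<in>{row_len M a..b}. ?Y j)"
      by (simp add: sum_product sum.cartesian_product)
    also have "\<dots> = corner_ratio D M c"
      using sum_walk_weight[OF le(1), of "\<lambda>r. excess D (r, b)"]
        sum_walk_weight[OF le(2), of "\<lambda>s. excess D (a, s)"] ex
      by (simp add: corner_ratio_def c_eq)
    finally show ?thesis .
  qed
  moreover have "?S \<subseteq> ?R"
  proof
    fix u assume u: "u \<in> ?S"
    obtain i j where u_eq: "u = (i, j)" by (cases u)
    then have ij: "i \<le> a" "j \<le> b" "(i, j) \<notin> M" using u by auto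
    then have "(i, b) \<notin> M" "(a, j) \<notin> M"
      using diagram_down[OF M, of i b i j] diagram_down[OF M, of a j i j] by auto
    then show "u \<in> ?R"
      using ij u_eq mem_diagram_col[OF M, of i b] mem_diagram_row[OF M, of a j] by simp
  qed
  moreover have "(\<Sum>u\<in>?S. walk_prob D c u) \<le> (\<Sum>u\<in>?R. walk_prob D c u)"
    using \<open>?S \<subseteq> ?R\<close> walk_prob_nonneg[OF D] c by (intro sum_mono2) auto
  moreover have "?S = ?R" if "M = {}"
    using that by (auto simp: col_len_def row_len_def)
  ultimately show "(\<Sum>u\<in>D - M. walk_prob D c u) \<le> corner_ratio D M c"
    and "M = {} \<Longrightarrow> (\<Sum>u\<in>D - M. walk_prob D c u) = corner_ratio D M c"
    by simp_all
qed

text \<open>The cells of $D\setminus M$ are the starting cells of walks, sorted by the corner in which a walk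
ends. A walk only moves right and down, so it cannot enter $M$.\<close>

lemma sum_corner_ratio:
  assumes D: "diagram D" and M: "diagram M"
  shows "real (card (D - M)) \<le> (\<Sum>c\<in>corners D - M. corner_ratio D M c)"
    and "M = {} \<Longrightarrow> real (card (D - M)) = (\<Sum>c\<in>corners D - M. corner_ratio D M c)"
proof -
  have finc: "finite (corners D)" by (rule finite_corners[OF diagram_finite[OF D]])
  have zero: "walk_prob D c u = 0" if "c \<in> M" "u \<in> D - M" for c u
  proof -
    obtain a b i j where cu: "c = (a, b)" "u = (i, j)" by (cases c, cases u)
    then have "\<not> (i \<le> a \<and> j \<le> b)" using that diagram_down[OF M, of a b i j] by auto
    then show ?thesis by (auto simp: walk_prob_def cu)
  qed
  have "real (card (D - M)) = (\<Sum>u\<in>D - M. \<Sum>c\<in>corners D. walk_prob D c u)"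
    using sum_walk_prob[OF D] by simp
  also have "\<dots> = (\<Sum>u\<in>D - M. \<Sum>c\<in>corners D - M. walk_prob D c u)"
    using finc zero by (intro sum.cong refl sum.mono_neutral_right) auto
  also have "\<dots> = (\<Sum>c\<in>corners D - M. \<Sum>u\<in>D - M. walk_prob D c u)"
    by (rule sum.swap)
  finally have eq: "real (card (D - M)) = \<dots>" .
  show "real (card (D - M)) \<le> (\<Sum>c\<in>corners D - M. corner_ratio D M c)"
    unfolding eq by (intro sum_mono sum_walk_prob_skew D M)
  show "real (card (D - M)) = (\<Sum>c\<in>corners D - M. corner_ratio D M c)" if "M = {}"
    unfolding eq by (intro sum.cong refl sum_walk_prob_skew(2) D M that)
qed

lemma corner_ratio_nonneg:
  assumes "diagram D" "c \<in> corners D"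
  shows "corner_ratio D M c \<ge> 0"
proof -
  obtain a b where c: "c = (a, b)" by (cases c)
  note ex = excess_below_corner[OF assms[unfolded c]]
  have "1 + 1 / excess D (r, b) \<ge> 0" if "r < a" for r
    using ex(1)[OF that] by simp
  moreover have "1 + 1 / excess D (a, s) \<ge> 0" if "s < b" for s
    using ex(2)[OF that] by simp
  ultimately show ?thesis
    unfolding corner_ratio_def c prod.case by (intro mult_nonneg_nonneg prod_nonneg) auto
qed

lemma card_standard_tableaux_empty: "card (standard_tableaux {}) = 1"
proof -
  have "standard_tableaux {} = {\<lambda>_. undefined}"
    unfolding standard_tableaux_def extensional_empty by (auto simp: bij_betw_def)
  then show ?thesis by simp
qed

text \<open>Induction on the number of cells: removing the largest entry turns the claim into the inequality
\<open>sum_corner_ratio\<close>, which is an equation when $M$ is empty. The first part is the lower bound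
$f^{D/M}\ge n!/\prod_{u\in D\setminus M}h_D(u)$, with hooks taken in $D$; the second is the
hook-length formula. They share one induction because they share the recursion.\<close>

lemma hook_bound_and_formula:
  assumes "diagram D" and M: "diagram M"
  shows "fact (card (D - M)) \<le> real (card (standard_tableaux (D - M))) * (\<Prod>u\<in>D - M. real (hook D u))"
      (is "?lower D")
    and "M = {} \<Longrightarrow>
         fact (card (D - M)) = real (card (standard_tableaux (D - M))) * (\<Prod>u\<in>D - M. real (hook D u))"
      (is "_ \<Longrightarrow> ?exact D")
proof -
  have "?lower D \<and> (M = {} \<longrightarrow> ?exact D)"
    using assms(1)
  proof (induction "card (D - M)" arbitrary: D)
    case 0
    then have "D - M = {}" using diagram_finite by auto
    then show ?case by (simp only: card_standard_tableaux_empty) simp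
  next
    case (Suc n)
    note D = Suc.prems
    let ?f = "\<lambda>E. real (card (standard_tableaux E))"
    let ?H = "\<lambda>c. \<Prod>u\<in>D - M - {c}. real (hook (D - {c}) u)"
    have fin: "finite (D - M)" using diagram_finite[OF D] by simp
    have ne: "D - M \<noteq> {}" using Suc.hyps(2) by (metis card.empty nat.distinct(1))
    have IH: "fact n \<le> ?f (D - M - {c}) * ?H c \<and> (M = {} \<longrightarrow> fact n = ?f (D - M - {c}) * ?H c)"
      if "c \<in> corners D - M" for c
    proof -
      have eq: "D - {c} - M = D - M - {c}" by blast
      have "c \<in> D - M" using that by (auto simp: corners_def)
      then have "n = card (D - {c} - M)"
        using Suc.hyps(2) fin by (simp add: eq)
      then show ?thesis
        using Suc.hyps(1)[of "D - {c}"] diagram_remove_corner[OF D, of c] that unfolding eq by auto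
    qed
    have rec: "?f (D - M) * (\<Prod>u\<in>D - M. real (hook D u)) =
        (\<Sum>c\<in>corners D - M. ?f (D - M - {c}) * ?H c * corner_ratio D M c)"
    proof -
      have "?f (D - M) = (\<Sum>c\<in>corners D - M. ?f (D - M - {c}))"
        using card_standard_tableaux_recursion[OF fin ne] corners_skew[OF D M] by simp
      then show ?thesis
        unfolding \<open>?f (D - M) = _\<close> sum_distrib_right mult.assoc
        by (intro sum.cong refl arg_cong2[where f = "(*)"] prod_hook_remove_corner[OF D M])
    qed
    have "fact (Suc n) = fact n * real (card (D - M))" unfolding Suc.hyps(2)[symmetric] by simp
    also have "\<dots> \<le> fact n * (\<Sum>c\<in>corners D - M. corner_ratio D M c)"
      using sum_corner_ratio(1)[OF D M] by (intro mult_left_mono) auto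
    also have "\<dots> \<le> (\<Sum>c\<in>corners D - M. ?f (D - M - {c}) * ?H c * corner_ratio D M c)"
      unfolding sum_distrib_left using IH corner_ratio_nonneg[OF D]
      by (intro sum_mono mult_right_mono) auto
    finally have lower: "?lower D" unfolding rec Suc.hyps(2) .
    have "?exact D" if "M = {}"
    proof -
      have "fact (Suc n) = fact n * real (card (D - M))" unfolding Suc.hyps(2)[symmetric] by simp
      also have "\<dots> = (\<Sum>c\<in>corners D - M. fact n * corner_ratio D M c)"
        unfolding sum_corner_ratio(2)[OF D M that] sum_distrib_left ..
      also have "\<dots> = (\<Sum>c\<in>corners D - M. ?f (D - M - {c}) * ?H c * corner_ratio D M c)"
        using IH that by (intro sum.cong refl arg_cong2[where f = "(*)"]) auto
      finally show ?thesis unfolding rec Suc.hyps(2) .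
    qed
    with lower show ?case by blast
  qed
  then show "?lower D" "M = {} \<Longrightarrow> ?exact D" by blast+
qed

lemmas skew_hook_bound = hook_bound_and_formula(1)

corollary hook_length_formula:
  assumes "diagram D"
  shows "fact (card D) = real (card (standard_tableaux D)) * (\<Prod>u\<in>D. real (hook D u))"
  using hook_bound_and_formula(2)[OF assms, of "{}"] by (simp add: diagram_def)

corollary card_standard_tableaux_pos:
  assumes "diagram D" shows "card (standard_tableaux D) > 0"
proof -
  have "card (standard_tableaux D) \<noteq> 0"
    using hook_length_formula[OF assms] by (metis fact_nonzero mult_zero_left of_nat_0)
  then show ?thesis by simp
qed

section \<open>Concatenation of tableaux\<close>

text \<open>A standard tableau of shape $M$, continued by one of shape $D\setminus M$ with its entries shifted
by $|M|$, is a standard tableau of shape $D$.\<close>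

lemma card_standard_tableaux_concat:
  assumes D: "diagram D" and M: "diagram M" and sub: "M \<subseteq> D"
  shows "card (standard_tableaux (D - M)) * card (standard_tableaux M) \<le> card (standard_tableaux D)"
proof -
  define m where "m = card M"
  define glue :: "(nat \<times> nat \<Rightarrow> nat) \<times> (nat \<times> nat \<Rightarrow> nat) \<Rightarrow> nat \<times> nat \<Rightarrow> nat"
    where "glue = (\<lambda>(T, S) u. if u \<in> M then S u else if u \<in> D then m + T u else undefined)"
  have finD: "finite D" and finM: "finite M" using D M diagram_finite by blast+
  have card: "card D = m + card (D - M)"
    using finD finM sub card_mono[OF finD sub] by (simp add: card_Diff_subset m_def)
  have "glue (T, S) \<in> standard_tableaux D"
    if T: "T \<in> standard_tableaux (D - M)" and S: "S \<in> standard_tableaux M" for T S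
  proof -
    have bT: "bij_betw T (D - M) {1..card (D - M)}" and bS: "bij_betw S M {1..m}"
      using T S by (simp_all add: standard_tableaux_def m_def)
    have S_le: "S u \<le> m" if "u \<in> M" for u using bij_betwE[OF bS] that by auto
    have T_gt: "T u > 0" if "u \<in> D - M" for u using bij_betwE[OF bT] that by (metis One_nat_def Suc_le_eq atLeastAtMost_iff)
    have "bij_betw ((+) m) {1..card (D - M)} {m + 1..m + card (D - M)}"
      by (simp add: bij_betw_def)
    from bij_betw_trans[OF bT this]
    have "bij_betw (glue (T, S)) (D - M) {m + 1..m + card (D - M)}"
      by (rule bij_betw_cong[THEN iffD1, rotated]) (auto simp: glue_def)
    moreover have "bij_betw (glue (T, S)) M {1..m}"
      using bS by (rule bij_betw_cong[THEN iffD1, rotated]) (auto simp: glue_def)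
    ultimately have "bij_betw (glue (T, S)) (M \<union> (D - M)) ({1..m} \<union> {m + 1..m + card (D - M)})"
      by (intro bij_betw_combine) auto
    moreover have "M \<union> (D - M) = D" "{1..m} \<union> {m + 1..m + card (D - M)} = {1..card D}"
      using sub card by auto
    ultimately have bij: "bij_betw (glue (T, S)) D {1..card D}" by simp
    have "glue (T, S) (i, j) < glue (T, S) (i, j')" if "(i, j) \<in> D" "(i, j') \<in> D" "j < j'" for i j j'
    proof -
      have "(i, j) \<in> M" if "(i, j') \<in> M" using diagram_down[OF M that] \<open>j < j'\<close> by simp
      then show ?thesis
        using that T S S_le[of "(i, j)"] T_gt[of "(i, j')"]
        by (auto simp: glue_def standard_tableaux_def intro: le_less_trans)
    qed
    moreover have "glue (T, S) (i, j) < glue (T, S) (i', j)"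
      if "(i, j) \<in> D" "(i', j) \<in> D" "i < i'" for i i' j
    proof -
      have "(i, j) \<in> M" if "(i', j) \<in> M" using diagram_down[OF M that] \<open>i < i'\<close> by simp
      then show ?thesis
        using that T S S_le[of "(i, j)"] T_gt[of "(i', j)"]
        by (auto simp: glue_def standard_tableaux_def intro: le_less_trans)
    qed
    moreover have "glue (T, S) \<in> extensional D"
      using sub by (auto simp: glue_def extensional_def)
    ultimately show ?thesis using bij unfolding standard_tableaux_def by blast
  qed
  then have "glue ` (standard_tableaux (D - M) \<times> standard_tableaux M) \<subseteq> standard_tableaux D"
    by auto
  moreover have "inj_on glue (standard_tableaux (D - M) \<times> standard_tableaux M)"
  proof (rule inj_onI, clarify)
    fix T S T' S'
    assume TS: "T \<in> standard_tableaux (D - M)" "S \<in> standard_tableaux M"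
      "T' \<in> standard_tableaux (D - M)" "S' \<in> standard_tableaux M"
      and eq: "glue (T, S) = glue (T', S')"
    have "S u = S' u" if "u \<in> M" for u
      using fun_cong[OF eq, of u] that by (simp add: glue_def)
    moreover have "T u = T' u" if "u \<in> D - M" for u
      using fun_cong[OF eq, of u] that by (simp add: glue_def)
    ultimately show "T = T' \<and> S = S'"
      using TS extensionalityI[of T "D - M" T'] extensionalityI[of S M S']
      by (simp add: standard_tableaux_def)
  qed
  ultimately have "card (standard_tableaux (D - M) \<times> standard_tableaux M) \<le> card (standard_tableaux D)"
    using finite_standard_tableaux[OF finD] card_inj_on_le by blast
  then show ?thesis by (simp add: card_cartesian_product)
qed

section \<open>Staircases\<close>

text \<open>The double factorial $(2m-1)!!$.\<close>

definition odd_fact :: "nat \<Rightarrow> real" where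
  "odd_fact m = (\<Prod>d<m. 2 * real d + 1)"

text \<open>The product of all hooks of $\delta_m$, see \<open>prod_hook_stair\<close> below.\<close>

definition super_odd_fact :: "nat \<Rightarrow> real" where
  "super_odd_fact m = (\<Prod>i<m. odd_fact i)"

lemma odd_fact_pos: "odd_fact m > 0"
  unfolding odd_fact_def by (intro prod_pos) auto

lemma super_odd_fact_pos: "super_odd_fact m > 0"
  unfolding super_odd_fact_def by (intro prod_pos ballI odd_fact_pos)

abbreviation stair :: "nat \<Rightarrow> (nat \<times> nat) set" where
  "stair m \<equiv> young_diagram (staircase m)"

lemma stair_diff_eq_Sigma: "stair m - stair k = (SIGMA i:{..<m}. {k - 1 - i..<m - 1 - i})"
  by (auto simp: young_diagram_staircase)

lemma stair_empty: "stair 0 = {}"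
  by (simp add: young_diagram_staircase)

lemma diagram_stair: "diagram (stair m)"
proof -
  have "stair m = (SIGMA i:{..<m}. {0..<m - 1 - i})"
    using stair_diff_eq_Sigma[of m 0] by (simp add: stair_empty)
  then have "finite (stair m)" by simp
  then show ?thesis by (auto simp: diagram_def young_diagram_staircase)
qed

lemma hook_stair:
  assumes "(i, j) \<in> stair m"
  shows "real (hook (stair m) (i, j)) = 2 * real (m - 1 - i - 1 - j) + 1"
proof -
  have "{j. (i, j) \<in> stair m} = {..<m - 1 - i}" "{i. (i, j) \<in> stair m} = {..<m - 1 - j}"
    by (auto simp: young_diagram_staircase)
  then have "row_len (stair m) i = m - 1 - i" "col_len (stair m) j = m - 1 - j"
    by (simp_all add: row_len_def col_len_def)
  moreover have "i + j + 1 < m" using assms by (simp add: young_diagram_staircase)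
  ultimately show ?thesis by (simp add: hook_def of_nat_diff)
qed

text \<open>The hook of $(i,j)$ in the staircase only depends on $i+j$, so that every row of the skew shape
carries the hooks $1,3,5,\dots$, read from its right end.\<close>

lemma prod_hook_stair_diff:
  "(\<Prod>u\<in>stair m - stair k. real (hook (stair m) u)) =
     (\<Prod>i<m. odd_fact ((m - 1 - i) - (k - 1 - i)))"
proof -
  have row: "(\<Prod>j\<in>{a..<b}. 2 * real (b - 1 - j) + 1) = odd_fact (b - a)" for a b :: nat
    unfolding odd_fact_def
    by (rule prod.reindex_bij_witness[of _ "\<lambda>d. b - 1 - d" "\<lambda>j. b - 1 - j"]) auto
  have "(\<Prod>u\<in>stair m - stair k. real (hook (stair m) u)) =
      (\<Prod>(i, j)\<in>(SIGMA i:{..<m}. {k - 1 - i..<m - 1 - i}). 2 * real (m - 1 - i - 1 - j) + 1)"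
    by (rule prod.cong[OF stair_diff_eq_Sigma])
       (auto simp only: stair_diff_eq_Sigma[symmetric] prod.case Diff_iff intro!: hook_stair)
  also have "\<dots> = (\<Prod>i<m. \<Prod>j\<in>{k - 1 - i..<m - 1 - i}. 2 * real (m - 1 - i - 1 - j) + 1)"
    by (rule prod.Sigma[symmetric]) auto
  finally show ?thesis unfolding row .
qed

lemma prod_hook_stair: "(\<Prod>u\<in>stair m. real (hook (stair m) u)) = super_odd_fact m"
proof -
  have "(\<Prod>u\<in>stair m. real (hook (stair m) u)) = (\<Prod>i<m. odd_fact (m - 1 - i))"
    using prod_hook_stair_diff[of m 0] by (simp add: stair_empty)
  also have "\<dots> = super_odd_fact m"
    unfolding super_odd_fact_def
    by (rule prod.reindex_bij_witness[of _ "\<lambda>i. m - 1 - i" "\<lambda>i. m - 1 - i"]) auto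
  finally show ?thesis .
qed

text \<open>The first $k$ rows of $\delta_{2k}/\delta_k$ all have length $k$, and the remaining ones form
$\delta_k$.\<close>

lemma prod_hook_thick_staircase:
  "(\<Prod>u\<in>stair (2 * k) - stair k. real (hook (stair (2 * k)) u)) = odd_fact k ^ k * super_odd_fact k"
proof -
  let ?h = "\<lambda>i. odd_fact ((2 * k - 1 - i) - (k - 1 - i))"
  have "(\<Prod>i<2 * k. ?h i) = (\<Prod>i\<in>{..<k} \<union> {k..<2 * k}. ?h i)"
    by (rule prod.cong) auto
  also have "\<dots> = (\<Prod>i<k. ?h i) * (\<Prod>i\<in>{k..<2 * k}. ?h i)"
    by (rule prod.union_disjoint) auto
  also have "(\<Prod>i<k. ?h i) = odd_fact k ^ k"
    by simp
  also have "(\<Prod>i\<in>{k..<2 * k}. ?h i) = super_odd_fact k"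
    unfolding super_odd_fact_def
    by (rule prod.reindex_bij_witness[of _ "\<lambda>i. 2 * k - 1 - i" "\<lambda>i. 2 * k - 1 - i"]) auto
  finally show ?thesis unfolding prod_hook_stair_diff .
qed

lemma card_stair: "real (card (stair m)) = real m * (real m - 1) / 2"
proof -
  have "card (stair m) = (\<Sum>i<m. m - 1 - i)"
    using stair_diff_eq_Sigma[of m 0] by (simp add: stair_empty)
  also have "\<dots> = (\<Sum>i<m. i)"
    by (rule sum.reindex_bij_witness[of _ "\<lambda>i. m - 1 - i" "\<lambda>i. m - 1 - i"]) auto
  finally have "real (card (stair m)) = (\<Sum>i<m. real i)" by simp
  also have "\<dots> = real m * (real m - 1) / 2"
    by (induction m) (simp_all add: field_simps)
  finally show ?thesis .
qed

lemma card_thick_staircase: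
  "real (card (stair (2 * k) - stair k)) = real k * (3 * real k - 1) / 2"
proof -
  have sub: "stair k \<subseteq> stair (2 * k)" by (rule staircase_diagram_mono) simp
  have fin: "finite (stair m)" for m by (rule diagram_finite[OF diagram_stair])
  have "real (card (stair (2 * k) - stair k)) = real (card (stair (2 * k))) - real (card (stair k))"
    using card_mono[OF fin sub] by (simp add: card_Diff_subset[OF fin sub] of_nat_diff)
  then show ?thesis by (simp add: card_stair field_simps)
qed

lemma ln_num_SYT_stair:
  "ln (real (card (standard_tableaux (stair m)))) = ln (fact (card (stair m))) - ln (super_odd_fact m)"
proof -
  let ?f = "real (card (standard_tableaux (stair m)))"
  have "fact (card (stair m)) = ?f * super_odd_fact m"
    using hook_length_formula[OF diagram_stair] by (simp only: prod_hook_stair)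
  then show ?thesis
    using super_odd_fact_pos[of m] card_standard_tableaux_pos[OF diagram_stair, of m]
    by (simp add: ln_mult_pos)
qed

text \<open>The two bounds behind the theorem: the hook bound for the skew shape, and
$f^{\delta_{2k}/\delta_k}\,f^{\delta_k}\le f^{\delta_{2k}}$ with both straight shapes evaluated by the
hook-length formula.\<close>

lemma ln_num_SYT_thick_staircase:
  fixes k :: nat
  defines "f \<equiv> real (card (standard_tableaux (stair (2 * k) - stair k)))"
  shows "ln (fact (card (stair (2 * k) - stair k))) - real k * ln (odd_fact k) - ln (super_odd_fact k) \<le> ln f"
    and "ln f \<le> (ln (fact (card (stair (2 * k)))) - ln (super_odd_fact (2 * k)))
              - (ln (fact (card (stair k))) - ln (super_odd_fact k))"
proof -
  let ?H = "odd_fact k ^ k * super_odd_fact k"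
  have H: "?H > 0" using odd_fact_pos super_odd_fact_pos by simp
  have low: "fact (card (stair (2 * k) - stair k)) \<le> f * ?H"
    using skew_hook_bound[OF diagram_stair[of "2 * k"] diagram_stair[of k]]
    unfolding prod_hook_thick_staircase f_def .
  then have f: "f > 0"
    using H by (smt (verit) fact_gt_zero zero_less_mult_pos2)
  have "ln (fact (card (stair (2 * k) - stair k))) \<le> ln (f * ?H)"
    using low by (intro ln_mono) simp_all
  also have "\<dots> = ln f + real k * ln (odd_fact k) + ln (super_odd_fact k)"
    using f odd_fact_pos[of k] super_odd_fact_pos[of k] by (simp add: ln_mult_pos ln_realpow)
  finally show "ln (fact (card (stair (2 * k) - stair k))) - real k * ln (odd_fact k) - ln (super_odd_fact k) \<le> ln f"
    by simp
  let ?s = "\<lambda>m. real (card (standard_tableaux (stair m)))"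
  have "f * ?s k \<le> ?s (2 * k)"
    using card_standard_tableaux_concat[OF diagram_stair diagram_stair staircase_diagram_mono, of k "2 * k"]
    unfolding f_def by (simp flip: of_nat_mult)
  moreover have "?s k > 0"
    using card_standard_tableaux_pos[OF diagram_stair, of k] by simp
  ultimately have "ln (f * ?s k) \<le> ln (?s (2 * k))"
    using f by (intro ln_mono) simp_all
  moreover have "ln (f * ?s k) = ln f + ln (?s k)"
    using f \<open>?s k > 0\<close> by (rule ln_mult_pos)
  ultimately show "ln f \<le> (ln (fact (card (stair (2 * k)))) - ln (super_odd_fact (2 * k)))
              - (ln (fact (card (stair k))) - ln (super_odd_fact k))"
    unfolding ln_num_SYT_stair by simp
qed

section \<open>Asymptotic expansions\<close>

text \<open>The Stolz-Cesaro theorem in the form in which asymptotic estimates can be summed: it reduces each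
expansion below to a limit of an elementary function.\<close>

lemma stolz_cesaro_smallo:
  fixes x y :: "nat \<Rightarrow> real"
  assumes diff: "(\<lambda>n. x (Suc n) - x n) \<in> o(\<lambda>n. y (Suc n) - y n)"
    and mono: "incseq y" and lim: "filterlim y at_top sequentially"
  shows "x \<in> o(y)"
proof (rule landau_o.smallI)
  fix c :: real assume "c > 0"
  then have "\<forall>\<^sub>F n in sequentially. \<bar>x (Suc n) - x n\<bar> \<le> c / 2 * \<bar>y (Suc n) - y n\<bar>"
    using landau_o.smallD[OF diff, of "c / 2"] by simp
  then obtain N where N: "\<And>n. n \<ge> N \<Longrightarrow> \<bar>x (Suc n) - x n\<bar> \<le> c / 2 * \<bar>y (Suc n) - y n\<bar>"
    by (auto simp: eventually_sequentially)
  have tail: "\<bar>x n - x N\<bar> \<le> c / 2 * (y n - y N)" if "n \<ge> N" for n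
    using that
  proof (induction rule: dec_induct)
    case (step n)
    have "y n \<le> y (Suc n)" using mono by (simp add: incseq_SucD)
    then have "\<bar>x (Suc n) - x n\<bar> \<le> c / 2 * (y (Suc n) - y n)" using N[OF step.hyps(1)] by simp
    moreover have "\<bar>x (Suc n) - x N\<bar> \<le> \<bar>x (Suc n) - x n\<bar> + \<bar>x n - x N\<bar>" by linarith
    ultimately show ?case using step.IH by (simp add: algebra_simps)
  qed simp
  have "\<forall>\<^sub>F n in sequentially. y n \<ge> max 0 (2 / c * \<bar>x N\<bar> - y N)"
    using lim unfolding filterlim_at_top by (rule spec)
  then show "\<forall>\<^sub>F n in sequentially. norm (x n) \<le> c * norm (y n)"
    using eventually_ge_at_top[of N]
  proof eventually_elim
    case (elim n)
    then have "2 * \<bar>x N\<bar> \<le> c * (y n + y N)"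
      using \<open>c > 0\<close> by (simp add: field_simps)
    moreover have "\<bar>x n\<bar> \<le> \<bar>x N\<bar> + \<bar>x n - x N\<bar>" by linarith
    ultimately show ?case using tail[OF elim(2)] elim(1) by (simp add: algebra_simps)
  qed
qed

lemma ln_fact_asymp:
  "(\<lambda>n. ln (fact n) - (real n * ln (real n) - real n)) \<in> o(\<lambda>n. real n)"
proof (rule stolz_cesaro_smallo)
  have "ln (fact (Suc n)) = ln (real n + 1) + ln (fact n)" for n
    unfolding fact_Suc by (subst ln_mult_pos) (simp_all add: add.commute)
  then have eq: "(\<lambda>n. ln (fact (Suc n)) - (real (Suc n) * ln (real (Suc n)) - real (Suc n))
          - (ln (fact n) - (real n * ln (real n) - real n)))
        = (\<lambda>n. real n * ln (real n) - real n * ln (real n + 1) + 1)"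
    by (intro ext) (simp add: algebra_simps)
  show "(\<lambda>n. ln (fact (Suc n)) - (real (Suc n) * ln (real (Suc n)) - real (Suc n))
          - (ln (fact n) - (real n * ln (real n) - real n))) \<in> o(\<lambda>n. real (Suc n) - real n)"
    unfolding eq by real_asymp
  show "filterlim (\<lambda>n. real n) at_top sequentially" by real_asymp
qed (simp add: incseq_def)

lemma ln_odd_fact_asymp:
  "(\<lambda>m. ln (odd_fact m) - (real m * ln (2 * real m) - real m)) \<in> o(\<lambda>m. real m)"
proof (rule stolz_cesaro_smallo)
  have "odd_fact (Suc m) = odd_fact m * (2 * real m + 1)" for m
    by (simp add: odd_fact_def)
  then have "ln (odd_fact (Suc m)) = ln (odd_fact m) + ln (2 * real m + 1)" for m
    using odd_fact_pos[of m] by (simp add: ln_mult_pos)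
  then have eq: "(\<lambda>m. ln (odd_fact (Suc m)) - (real (Suc m) * ln (2 * real (Suc m)) - real (Suc m))
          - (ln (odd_fact m) - (real m * ln (2 * real m) - real m)))
        = (\<lambda>m. ln (2 * real m + 1) - (real m + 1) * ln (2 * real m + 2) + real m * ln (2 * real m) + 1)"
    by (intro ext) (simp add: algebra_simps)
  show "(\<lambda>m. ln (odd_fact (Suc m)) - (real (Suc m) * ln (2 * real (Suc m)) - real (Suc m))
          - (ln (odd_fact m) - (real m * ln (2 * real m) - real m))) \<in> o(\<lambda>m. real (Suc m) - real m)"
    unfolding eq by real_asymp
  show "filterlim (\<lambda>n. real n) at_top sequentially" by real_asymp
qed (simp add: incseq_def)

text \<open>The increments of the left-hand side are known from \<open>ln_odd_fact_asymp\<close>. The main term is the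
antiderivative of $x\ln(2x)-x$.\<close>

lemma ln_super_odd_fact_asymp:
  "(\<lambda>m. ln (super_odd_fact m) - (real m ^ 2 / 2 * ln (2 * real m) - 3 / 4 * real m ^ 2))
     \<in> o(\<lambda>m. real m ^ 2)"
proof (rule stolz_cesaro_smallo)
  let ?G = "\<lambda>m. real m ^ 2 / 2 * ln (2 * real m) - 3 / 4 * real m ^ 2"
  let ?g = "\<lambda>m. real m * ln (2 * real m) - real m"
  have "super_odd_fact (Suc m) = super_odd_fact m * odd_fact m" for m
    by (simp add: super_odd_fact_def)
  then have step: "ln (super_odd_fact (Suc m)) = ln (super_odd_fact m) + ln (odd_fact m)" for m
    using odd_fact_pos[of m] super_odd_fact_pos[of m] by (simp add: ln_mult_pos)
  have eq: "(\<lambda>m. ln (super_odd_fact (Suc m)) - ?G (Suc m) - (ln (super_odd_fact m) - ?G m))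
      = (\<lambda>m. (ln (odd_fact m) - ?g m) + (?g m - (?G (Suc m) - ?G m)))"
    unfolding step by (intro ext) linarith
  have "(\<lambda>m. real m) \<in> O(\<lambda>m. real (Suc m) ^ 2 - real m ^ 2)"
    by real_asymp
  then have "(\<lambda>m. ln (odd_fact m) - ?g m) \<in> o(\<lambda>m. real (Suc m) ^ 2 - real m ^ 2)"
    by (rule landau_o.small_big_trans[OF ln_odd_fact_asymp])
  moreover have "(\<lambda>m. ?g m - (?G (Suc m) - ?G m)) \<in> o(\<lambda>m. real (Suc m) ^ 2 - real m ^ 2)"
    by real_asymp
  ultimately show "(\<lambda>m. ln (super_odd_fact (Suc m)) - ?G (Suc m) - (ln (super_odd_fact m) - ?G m))
      \<in> o(\<lambda>m. real (Suc m) ^ 2 - real m ^ 2)"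
    unfolding eq by (rule sum_in_smallo)
  show "filterlim (\<lambda>m. real m ^ 2) at_top sequentially" by real_asymp
qed (simp add: incseq_def power_mono)

text \<open>As $n\sim\frac32k^2$, only terms of order $k^2$ matter in an expansion of $\ln f$. Here \<open>X\<close> is a
bound for $\ln f$ and \<open>E\<close> its main term.\<close>

lemma normalised_log_limit:
  fixes n :: "nat \<Rightarrow> nat"
  assumes n: "\<And>k. real (n k) = real k * (3 * real k - 1) / 2"
    and main: "((\<lambda>k. 1 / (real k * (3 * real k - 1) / 2) * E k
          - 1 / 2 * ln (real k * (3 * real k - 1) / 2)) \<longlongrightarrow> L) sequentially"
    and err: "(\<lambda>k. X k - E k) \<in> o(\<lambda>k. real k ^ 2)"
  shows "((\<lambda>k. 1 / real (n k) * X k - 1 / 2 * ln (real (n k))) \<longlongrightarrow> L) sequentially"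
proof -
  have "(\<lambda>k. real k ^ 2) \<in> O(\<lambda>k. real k * (3 * real k - 1) / 2)" by real_asymp
  from landau_o.small_big_trans[OF err this]
  have "((\<lambda>k. (X k - E k) / (real k * (3 * real k - 1) / 2)) \<longlongrightarrow> 0) sequentially"
    by (rule smalloD_tendsto)
  from tendsto_add[OF main this] show ?thesis
    unfolding n by (simp add: algebra_simps diff_divide_distrib)
qed

lemma hook_bound_limit:
  fixes n :: "nat \<Rightarrow> nat"
  assumes n: "\<And>k. real (n k) = real k * (3 * real k - 1) / 2"
  shows "((\<lambda>k. 1 / real (n k) * (ln (fact (n k)) - real k * ln (odd_fact k) - ln (super_odd_fact k))
            - 1 / 2 * ln (real (n k))) \<longlongrightarrow> 1 / 6 - 3 / 2 * ln 2 + 1 / 2 * ln 3) sequentially"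
proof (rule normalised_log_limit[OF n])
  let ?f = "\<lambda>n. real n * ln (real n) - real n"
  let ?g = "\<lambda>m. real m * ln (2 * real m) - real m"
  let ?G = "\<lambda>m. real m ^ 2 / 2 * ln (2 * real m) - 3 / 4 * real m ^ 2"
  let ?n = "\<lambda>k. real k * (3 * real k - 1) / 2"
  let ?E = "\<lambda>k. (?n k * ln (?n k) - ?n k) - real k * ?g k - ?G k"
  have "((\<lambda>k. 1 / ?n k * ?E k - 1 / 2 * ln (?n k))
      \<longlongrightarrow> (3 * ln (3 / 2) + 1 / 2 - 3 * ln 2) / 3 - ln (3 / 2) / 2) sequentially"
    by real_asymp
  also have "(3 * ln (3 / 2) + 1 / 2 - 3 * ln 2) / 3 - ln (3 / 2) / 2 =
      1 / 6 - 3 / 2 * ln 2 + 1 / 2 * (ln 3 :: real)"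
    by (simp add: ln_div field_simps)
  finally show "((\<lambda>k. 1 / ?n k * ?E k - 1 / 2 * ln (?n k)) \<longlongrightarrow> 1 / 6 - 3 / 2 * ln 2 + 1 / 2 * ln 3) sequentially" .
  have "filterlim ?n at_top sequentially" by real_asymp
  then have "filterlim n sequentially sequentially"
    unfolding n[symmetric] filterlim_sequentially_iff_filterlim_real .
  from landau_o.small.compose[OF ln_fact_asymp this]
  have "(\<lambda>k. ln (fact (n k)) - ?f (n k)) \<in> o(?n)" unfolding n .
  moreover have "?n \<in> O(\<lambda>k. real k ^ 2)" by real_asymp
  ultimately have 1: "(\<lambda>k. ln (fact (n k)) - ?f (n k)) \<in> o(\<lambda>k. real k ^ 2)"
    by (rule landau_o.small_big_trans)
  have 2: "(\<lambda>k. real k * (ln (odd_fact k) - ?g k)) \<in> o(\<lambda>k. real k ^ 2)"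
    using landau_o.small.mult_left[OF ln_odd_fact_asymp, of real] by (simp add: power2_eq_square)
  have "(\<lambda>k. (ln (fact (n k)) - ?f (n k)) - real k * (ln (odd_fact k) - ?g k)
         - (ln (super_odd_fact k) - ?G k)) \<in> o(\<lambda>k. real k ^ 2)"
    by (intro sum_in_smallo 1 2 ln_super_odd_fact_asymp)
  also have "(\<lambda>k. (ln (fact (n k)) - ?f (n k)) - real k * (ln (odd_fact k) - ?g k)
         - (ln (super_odd_fact k) - ?G k)) =
      (\<lambda>k. ln (fact (n k)) - real k * ln (odd_fact k) - ln (super_odd_fact k) - ?E k)"
    unfolding n by (rule ext) (simp only: algebra_simps)
  finally show "(\<lambda>k. ln (fact (n k)) - real k * ln (odd_fact k) - ln (super_odd_fact k) - ?E k)
      \<in> o(\<lambda>k. real k ^ 2)" .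
qed

lemma concatenation_bound_limit:
  fixes n N M :: "nat \<Rightarrow> nat"
  assumes n: "\<And>k. real (n k) = real k * (3 * real k - 1) / 2"
    and N: "\<And>k. real (N k) = real k * (2 * real k - 1)"
    and M: "\<And>k. real (M k) = real k * (real k - 1) / 2"
  shows "((\<lambda>k. 1 / real (n k) * ((ln (fact (N k)) - ln (super_odd_fact (2 * k)))
              - (ln (fact (M k)) - ln (super_odd_fact k)))
            - 1 / 2 * ln (real (n k))) \<longlongrightarrow> 1 / 2 - 1 / 6 * ln 2 - 1 / 2 * ln 3) sequentially"
proof (rule normalised_log_limit[OF n])
  let ?f = "\<lambda>n. real n * ln (real n) - real n"
  let ?G = "\<lambda>m. real m ^ 2 / 2 * ln (2 * real m) - 3 / 4 * real m ^ 2"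
  let ?n = "\<lambda>k. real k * (3 * real k - 1) / 2"
  let ?N = "\<lambda>k. real k * (2 * real k - 1)"
  let ?M = "\<lambda>k. real k * (real k - 1) / 2"
  let ?G2 = "\<lambda>k. (2 * real k) ^ 2 / 2 * ln (2 * (2 * real k)) - 3 / 4 * (2 * real k) ^ 2"
  let ?E = "\<lambda>k. (?N k * ln (?N k) - ?N k - ?G2 k) - (?M k * ln (?M k) - ?M k - ?G k)"
  have "((\<lambda>k. 1 / ?n k * ?E k - 1 / 2 * ln (?n k))
      \<longlongrightarrow> (3 / 2 + (5 * ln 2 + (- ln (1 / 2) - 4 * ln 4))) / 3 - ln (3 / 2) / 2) sequentially"
    by real_asymp
  also have "(3 / 2 + (5 * ln 2 + (- ln (1 / 2) - 4 * ln 4))) / 3 - ln (3 / 2) / 2 =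
      1 / 2 - 1 / 6 * ln 2 - 1 / 2 * (ln 3 :: real)"
    using ln_realpow[of "2 :: real" 2] by (simp add: ln_div field_simps)
  finally show "((\<lambda>k. 1 / ?n k * ?E k - 1 / 2 * ln (?n k)) \<longlongrightarrow> 1 / 2 - 1 / 6 * ln 2 - 1 / 2 * ln 3) sequentially" .
  have "filterlim ?N at_top sequentially" by real_asymp
  then have "filterlim N sequentially sequentially"
    unfolding N[symmetric] filterlim_sequentially_iff_filterlim_real .
  from landau_o.small.compose[OF ln_fact_asymp this]
  have "(\<lambda>k. ln (fact (N k)) - ?f (N k)) \<in> o(?N)" unfolding N .
  moreover have "?N \<in> O(\<lambda>k. real k ^ 2)" by real_asymp
  ultimately have 1: "(\<lambda>k. ln (fact (N k)) - ?f (N k)) \<in> o(\<lambda>k. real k ^ 2)"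
    by (rule landau_o.small_big_trans)
  have "filterlim ?M at_top sequentially" by real_asymp
  then have "filterlim M sequentially sequentially"
    unfolding M[symmetric] filterlim_sequentially_iff_filterlim_real .
  from landau_o.small.compose[OF ln_fact_asymp this]
  have "(\<lambda>k. ln (fact (M k)) - ?f (M k)) \<in> o(?M)" unfolding M .
  moreover have "?M \<in> O(\<lambda>k. real k ^ 2)" by real_asymp
  ultimately have 2: "(\<lambda>k. ln (fact (M k)) - ?f (M k)) \<in> o(\<lambda>k. real k ^ 2)"
    by (rule landau_o.small_big_trans)
  have "filterlim (\<lambda>k::nat. 2 * k) sequentially sequentially" by real_asymp
  from landau_o.small.compose[OF ln_super_odd_fact_asymp this]
  have 3: "(\<lambda>k. ln (super_odd_fact (2 * k)) - ?G2 k) \<in> o(\<lambda>k. real k ^ 2)"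
    by (simp add: power_mult_distrib)
  have "(\<lambda>k. ((ln (fact (N k)) - ?f (N k)) - (ln (super_odd_fact (2 * k)) - ?G2 k)) -
         ((ln (fact (M k)) - ?f (M k)) - (ln (super_odd_fact k) - ?G k))) \<in> o(\<lambda>k. real k ^ 2)"
    by (intro sum_in_smallo 1 2 3 ln_super_odd_fact_asymp)
  also have "(\<lambda>k. ((ln (fact (N k)) - ?f (N k)) - (ln (super_odd_fact (2 * k)) - ?G2 k)) -
         ((ln (fact (M k)) - ?f (M k)) - (ln (super_odd_fact k) - ?G k))) =
      (\<lambda>k. (ln (fact (N k)) - ln (super_odd_fact (2 * k)))
         - (ln (fact (M k)) - ln (super_odd_fact k)) - ?E k)"
    unfolding N M by (rule ext) (simp only: algebra_simps)
  finally show "(\<lambda>k. (ln (fact (N k)) - ln (super_odd_fact (2 * k)))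
         - (ln (fact (M k)) - ln (super_odd_fact k)) - ?E k) \<in> o(\<lambda>k. real k ^ 2)" .
qed

section \<open>The asymptotic bounds\<close>

text \<open>Equivalent to $\ln(4/3)>2/9$; the bound $\ln x\le x-1$ at $x=3/4$ gives $\ln(4/3)\ge1/4$.\<close>

lemma lower_constant_less: "1 / 2 - 9 / 2 * ln 2 + 2 * ln 3 < 1 / 6 - 3 / 2 * ln 2 + 1 / 2 * (ln 3 :: real)"
proof -
  have "(1 / 4 :: real) \<le> ln (4 / 3)"
    using ln_le_minus_one[of "3 / 4 :: real"] by (simp add: ln_div)
  then show ?thesis using ln_realpow[of "2 :: real" 2] by (simp add: ln_div)
qed

text \<open>Equivalent to $2^{19}<3^{12}$, that is, $524288<531441$.\<close>

lemma upper_constant_less: "1 / 2 - 1 / 6 * ln 2 - 1 / 2 * ln 3 < 1 / 2 - 13 / 2 * ln 2 + 7 / 2 * (ln 3 :: real)"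
proof -
  have "ln ((2 :: real) ^ 19) < ln (3 ^ 12)"
    by (subst ln_less_cancel_iff) simp_all
  then have "19 * ln 2 < 12 * (ln 3 :: real)"
    by (simp only: ln_realpow zero_less_numeral of_nat_numeral)
  then show ?thesis by simp
qed

theorem theorem1p4:
  "\<exists>e1 e2 :: nat \<Rightarrow> real.
     e1 \<in> o(\<lambda>_. 1) \<and> e2 \<in> o(\<lambda>_. 1) \<and>
     (\<forall>\<^sub>F k in sequentially. even k \<longrightarrow>
       (let n = real (skew_size (staircase (2 * k)) (staircase k));
            f = real (num_skew_SYT (staircase (2 * k)) (staircase k));
            L = 1 / n * ln f - 1 / 2 * ln n
        in 1 / 2 - 9 / 2 * ln 2 + 2 * ln 3 + e1 k \<le> L \<and>
           L \<le> 1 / 2 - 13 / 2 * ln 2 + 7 / 2 * ln 3 + e2 k))"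
proof -
  let ?n = "\<lambda>k. card (stair (2 * k) - stair k)"
  let ?f = "\<lambda>k. real (card (standard_tableaux (stair (2 * k) - stair k)))"
  have skew: "skew_diagram (staircase (2 * k)) (staircase k) = stair (2 * k) - stair k" for k
    by (simp add: skew_diagram_def)
  have N: "real (card (stair (2 * k))) = real k * (2 * real k - 1)" for k
    by (simp add: card_stair)
  \<comment> \<open>Both limits lie strictly inside the claimed interval, so the error terms can be taken to be 0.\<close>
  have "\<forall>\<^sub>F k in sequentially. 1 / 2 - 9 / 2 * ln 2 + 2 * ln 3 <
      1 / real (?n k) * (ln (fact (?n k)) - real k * ln (odd_fact k) - ln (super_odd_fact k))
        - 1 / 2 * ln (real (?n k))"
    by (rule order_tendstoD(1)[OF hook_bound_limit[OF card_thick_staircase] lower_constant_less])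
  moreover have "\<forall>\<^sub>F k in sequentially.
      1 / real (?n k) * ((ln (fact (card (stair (2 * k)))) - ln (super_odd_fact (2 * k)))
          - (ln (fact (card (stair k))) - ln (super_odd_fact k)))
        - 1 / 2 * ln (real (?n k)) < 1 / 2 - 13 / 2 * ln 2 + 7 / 2 * ln 3"
    by (rule order_tendstoD(2)[OF concatenation_bound_limit[OF card_thick_staircase N card_stair] upper_constant_less])
  ultimately have "\<forall>\<^sub>F k in sequentially.
      1 / 2 - 9 / 2 * ln 2 + 2 * ln 3 \<le> 1 / real (?n k) * ln (?f k) - 1 / 2 * ln (real (?n k)) \<and>
      1 / real (?n k) * ln (?f k) - 1 / 2 * ln (real (?n k)) \<le> 1 / 2 - 13 / 2 * ln 2 + 7 / 2 * ln 3"
  proof eventually_elim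
    case (elim k)
    have "1 / real (?n k) \<ge> 0" by simp
    from mult_left_mono[OF ln_num_SYT_thick_staircase(1)[of k] this]
      mult_left_mono[OF ln_num_SYT_thick_staircase(2)[of k] this] elim
    show ?case by linarith
  qed
  then have "\<forall>\<^sub>F k in sequentially. even k \<longrightarrow>
       (let n = real (skew_size (staircase (2 * k)) (staircase k));
            f = real (num_skew_SYT (staircase (2 * k)) (staircase k));
            L = 1 / n * ln f - 1 / 2 * ln n
        in 1 / 2 - 9 / 2 * ln 2 + 2 * ln 3 + 0 \<le> L \<and>
           L \<le> 1 / 2 - 13 / 2 * ln 2 + 7 / 2 * ln 3 + 0)"
    unfolding skew_size_def num_skew_SYT_def skew Let_def by eventually_elim simp
  then show ?thesis
    by (intro exI[of _ "\<lambda>_. 0"] conjI) simp_all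
qed

end
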